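(* Let $L$ be a lattice and let $G\subseteq L$ be a generating set for $L$. Suppose that the following three conditions hold. (1) Every non-minimal prime element of $L$ is below only finitely many maximal elements. (2) If $a\in L$ and $p_1,\dots,p_n\in \mathrm{Spec}(L)$ are such that $a\not\le p_i$ for $i=1,\dots,n$, then there exists some $g\in G$ such that $g\le a$ and $g\not\le p_i$ for $i=1,\dots,n$. (3) $gh$ has a CPR-factorization for every $g,h\in G\setminus\{1\}$. Then $L$ is a CPR-lattice.
   Context: A multiplicative lattice is an ordered commutative monoid $(L,\le,\cdot)$ such that $(L,\le)$ is a complete lattice with top element $1$ and bottom element $0$, $0\ne 1$; $x(\bigvee Y)=\bigvee_{y\in Y}xy$ for all $x\in L$, $Y\subseteq L$; and $x1=x$ for all $x\in L$. An element $c\in L$ is compact if $c\le\bigvee H$ with $H\subseteq L$ implies $c\le\bigvee F$ for some finite $F\subseteq H$. A subset $G\subseteq L$ generates $L$ (is a generating set for $L$) if every element of $L$ is the join of some subset of $G$. Throughout, "lattice" means a multiplicative lattice $L$ such that (i) $1$ is compact, (ii) $L$ is generated by the set of its compact elements, (iii) every product of two compact elements is compact. Maximal elements are the maximal elements of $L\setminus\{1\}$. An element $p\ne 1$ is prime if $xy\le p$ implies $x\le p$ or $y\le p$; $\mathrm{Spec}(L)$ is the set of prime elements, and a prime is non-minimal if it is not a minimal element of $\mathrm{Spec}(L)$. The radical of $a\in L$ is $\sqrt{a}=\bigvee\{x\in L : x^n\le a \text{ for some } n\ge 1\}$. Elements $a,b\in L$ are comaximal if $a\vee b=1$. For $a\in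 L\setminus\{1\}$, a CPR-factorization (comaximal prime radical factorization) of $a$ is a factorization $a=a_1\cdots a_n$ ($n\ge1$) with $a_1,\dots,a_n\in L\setminus\{1\}$ pairwise comaximal such that each $\sqrt{a_i}$ is a prime element. $L$ is a CPR-lattice if every $x\in L\setminus\{1\}$ has a CPR-factorization. *)

theory Defs
  imports Main
begin

text \<open>
  A multiplicative lattice is a type: \<^term>\<open>Sup\<close> is the join, \<^term>\<open>bot\<close> is the least element 0, and
  the monoid unit \<^term>\<open>1\<close> is required to be the greatest element.
\<close>

class multiplicative_lattice = complete_lattice + comm_monoid_mult +
  assumes mult_mono_right: "x \<le> y \<Longrightarrow> z * x \<le> z * y"
    and one_eq_top: "1 = top"
    and bot_neq_one: "bot \<noteq> 1"
    and mult_Sup: "x * Sup Y = (SUP y\<in>Y. x * y)"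

definition (in complete_lattice) compact_element :: "'a \<Rightarrow> bool" where
  "compact_element c \<longleftrightarrow> (\<forall>H. c \<le> Sup H \<longrightarrow> (\<exists>F. F \<subseteq> H \<and> finite F \<and> c \<le> Sup F))"

definition (in complete_lattice) generating_set :: "'a set \<Rightarrow> bool" where
  "generating_set G \<longleftrightarrow> (\<forall>x. \<exists>A. A \<subseteq> G \<and> x = Sup A)"

class compactly_generated_multiplicative_lattice = multiplicative_lattice +
  assumes compact_one: "compact_element 1"
    and compacts_generate: "generating_set {c. compact_element c}"
    and compact_mult: "compact_element x \<Longrightarrow> compact_element y \<Longrightarrow> compact_element (x * y)"

context multiplicative_lattice
begin

definition maximal_element :: "'a \<Rightarrow> bool" where
  "maximal_element m \<longleftrightarrow> m \<noteq> 1 \<and> (\<forall>x. x \<noteq> 1 \<longrightarrow> m \<le> x \<longrightarrow> x = m)"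

definition prime_element :: "'a \<Rightarrow> bool" where
  "prime_element p \<longleftrightarrow> p \<noteq> 1 \<and> (\<forall>x y. x * y \<le> p \<longrightarrow> x \<le> p \<or> y \<le> p)"

definition spectrum :: "'a set" where
  "spectrum = {p. prime_element p}"

definition minimal_prime :: "'a \<Rightarrow> bool" where
  "minimal_prime p \<longleftrightarrow> p \<in> spectrum \<and> (\<forall>q\<in>spectrum. q \<le> p \<longrightarrow> q = p)"

definition radical :: "'a \<Rightarrow> 'a" where
  "radical a = Sup {x. \<exists>n\<ge>1. x ^ n \<le> a}"

definition comaximal :: "'a \<Rightarrow> 'a \<Rightarrow> bool" where
  "comaximal a b \<longleftrightarrow> sup a b = 1"

definition CPR_factorization :: "'a \<Rightarrow> 'a list \<Rightarrow> bool" where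
  "CPR_factorization a as \<longleftrightarrow>
     as \<noteq> [] \<and> a = prod_list as \<and>
     (\<forall>i<length as. as ! i \<noteq> 1 \<and> prime_element (radical (as ! i))) \<and>
     (\<forall>i<length as. \<forall>j<length as. i \<noteq> j \<longrightarrow> comaximal (as ! i) (as ! j))"

definition has_CPR_factorization :: "'a \<Rightarrow> bool" where
  "has_CPR_factorization a \<longleftrightarrow> (\<exists>as. CPR_factorization a as)"

end

definition CPR_lattice :: "'a::multiplicative_lattice itself \<Rightarrow> bool" where
  "CPR_lattice _ \<longleftrightarrow> (\<forall>x::'a. x \<noteq> 1 \<longrightarrow> has_CPR_factorization x)"

end

theory Submission
  imports Defs
begin

text \<open>
  Call a prime minimal over \<open>a\<close> if it is minimal among the primes above \<open>a\<close>. The bridge from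
  factorizations to primes is that a proper element \<open>a\<close> has a CPR-factorization as soon as the primes
  minimal over it are finitely many and pairwise comaximal (\<open>CPR_factorization_from_minimal_primes\<close>);
  the factors are obtained by lifting the product of these primes from the radical of \<open>a\<close> to \<open>a\<close>,
  using powers of compact elements. Both properties then have to be derived for every proper \<open>a\<close>.

  Comaximality: two incomparable primes \<open>p\<close>, \<open>q\<close> are always comaximal
  (\<open>incomparable_primes_comaximal\<close>). Avoidance gives generators \<open>g \<le> p\<close>, \<open>h \<le> q\<close> with
  \<open>\<not> g \<le> q\<close> and \<open>\<not> h \<le> p\<close>. In a CPR-factorization of \<open>g * h\<close>, each of \<open>p\<close>, \<open>q\<close> lies above some
  factor. It cannot be the same factor for both, since its radical would be a prime above \<open>g\<close> or
  \<open>h\<close> and below both \<open>p\<close> and \<open>q\<close>; and distinct factors are comaximal.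

  Finiteness: the lattice has finitely many minimal primes, because \<open>0\<close> is either prime or a product
  of two proper generators. Given \<open>a\<close>, choose a generator \<open>g \<le> a\<close> that avoids those minimal primes
  which \<open>a\<close> avoids. There are finitely many primes minimal over \<open>g\<close>, since \<open>g * g\<close> has a
  CPR-factorization. A prime \<open>p\<close> minimal over \<open>a\<close> lies above one of them, say \<open>r\<close>. If \<open>r\<close> is a
  minimal prime, the choice of \<open>g\<close> forces \<open>a \<le> r\<close>, so \<open>p = r\<close>. Otherwise only finitely many maximal
  elements lie above \<open>r\<close>, and by comaximality each of them is above at most one such \<open>p\<close>.
\<close>

section \<open>Arithmetic of multiplicative lattices\<close>

lemma le_one: "(x::'a::multiplicative_lattice) \<le> 1"
  by (simp add: one_eq_top)

lemma mult_mono_lattice: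
  fixes x y z w :: "'a::multiplicative_lattice"
  assumes "x \<le> y" "z \<le> w"
  shows "x * z \<le> y * w"
  by (metis assms mult_mono_right mult.commute order_trans)

lemma mult_le_left: "(x::'a::multiplicative_lattice) * y \<le> x"
  using mult_mono_right[OF le_one, of x y] by simp

lemma mult_le_right: "(x::'a::multiplicative_lattice) * y \<le> y"
  using mult_le_left[of y x] by (simp add: mult.commute)

lemma mult_sup_distrib:
  "(x::'a::multiplicative_lattice) * sup y z = sup (x * y) (x * z)"
  using mult_Sup[of x "{y, z}"] by simp

lemma sup_mult_sup_le:
  fixes p x y :: "'a::multiplicative_lattice"
  shows "sup p x * sup p y \<le> sup p (x * y)"
proof -
  have "sup p x * sup p y = sup (sup p x * p) (sup (y * p) (y * x))"
    by (metis mult_sup_distrib mult.commute)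
  also have "\<dots> \<le> sup p (x * y)"
    by (metis mult_le_right mult.commute le_supI le_supI1 sup_ge2)
  finally show ?thesis .
qed

lemma comaximal_sym: "comaximal x y \<longleftrightarrow> comaximal y (x::'a::multiplicative_lattice)"
  by (simp add: comaximal_def sup_commute)

lemma comaximal_mono:
  fixes x y :: "'a::multiplicative_lattice"
  assumes "comaximal x y" "x \<le> x'" "y \<le> y'"
  shows "comaximal x' y'"
  using assms sup_mono[of x x' y y'] le_one[of "sup x' y'"] unfolding comaximal_def
  by (metis order_antisym)

lemma comaximal_mult:
  fixes x y z :: "'a::multiplicative_lattice"
  assumes "comaximal x y" "comaximal x z"
  shows "comaximal x (y * z)"
  using assms sup_mult_sup_le[of x y z] le_one[of "sup x (y * z)"] unfolding comaximal_def
  by (metis mult_1 order_antisym)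

lemma comaximal_one: "comaximal (x::'a::multiplicative_lattice) 1"
  unfolding comaximal_def by (metis le_one sup.absorb2)

lemma comaximal_power: "comaximal x y \<Longrightarrow> comaximal x ((y::'a::multiplicative_lattice) ^ n)"
  by (induction n) (simp_all add: comaximal_one comaximal_mult)

lemma comaximal_prod:
  assumes "finite S" "\<And>s. s \<in> S \<Longrightarrow> comaximal (x::'a::multiplicative_lattice) (f s)"
  shows "comaximal x (prod f S)"
  using assms by (induction S rule: finite_induct) (simp_all add: comaximal_one comaximal_mult)

text \<open>Multiplying \<open>1 = x \<squnion> y\<close> by \<open>a\<close> writes \<open>a\<close> as a join of two elements below \<open>x * y\<close>.\<close>

lemma le_mult_if_comaximal:
  fixes a x y :: "'a::multiplicative_lattice"
  assumes "a \<le> x" "a \<le> y" "comaximal x y"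
  shows "a \<le> x * y"
proof -
  have "a = sup (a * x) (a * y)"
    using assms(3) unfolding comaximal_def by (metis mult_sup_distrib mult_1_right)
  moreover have "a * x \<le> x * y" "a * y \<le> x * y"
    using mult_mono_lattice[OF order_refl assms(2), of x] mult_mono_lattice[OF assms(1) order_refl, of y]
    by (simp_all add: mult.commute)
  ultimately show ?thesis by (metis le_supI)
qed

lemma le_prod_if_pairwise_comaximal:
  fixes a :: "'a::multiplicative_lattice"
  assumes "finite S" "\<And>s. s \<in> S \<Longrightarrow> a \<le> f s"
    and "\<And>s t. s \<in> S \<Longrightarrow> t \<in> S \<Longrightarrow> s \<noteq> t \<Longrightarrow> comaximal (f s) (f t)"
  shows "a \<le> prod f S"
  using assms
proof (induction S rule: finite_induct)
  case empty
  then show ?case by (simp add: le_one)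
next
  case (insert s S)
  have "comaximal (f s) (prod f S)"
    by (rule comaximal_prod[OF insert.hyps(1)]) (use insert.hyps(2) insert.prems(2) in blast)
  then have "a \<le> f s * prod f S"
    by (intro le_mult_if_comaximal) (use insert in auto)
  then show ?case using insert.hyps by simp
qed

lemma prod_sup_le:
  fixes a :: "'a::multiplicative_lattice"
  assumes "finite S"
  shows "(\<Prod>s\<in>S. sup a (f s)) \<le> sup a (prod f S)"
  using assms
proof (induction S rule: finite_induct)
  case empty
  then show ?case by simp
next
  case (insert s S)
  have "sup a (f s) * (\<Prod>s\<in>S. sup a (f s)) \<le> sup a (f s) * sup a (prod f S)"
    by (rule mult_mono_right[OF insert.IH])
  also have "\<dots> \<le> sup a (f s * prod f S)" by (rule sup_mult_sup_le)
  finally show ?case using insert.hyps by simp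
qed

lemma prod_le_factor:
  assumes "finite S" "s \<in> S"
  shows "prod f S \<le> (f s :: 'a::multiplicative_lattice)"
  using assms by (simp add: prod.remove mult_le_left)

lemma prod_power: "(\<Prod>s\<in>S. (f s :: 'a::comm_monoid_mult) ^ n) = prod f S ^ n"
  by (induction S rule: infinite_finite_induct) (simp_all add: power_mult_distrib)

section \<open>Compact elements\<close>

lemma compact_Sup_finite:
  assumes "finite F" "\<And>x. x \<in> F \<Longrightarrow> compact_element x"
  shows "compact_element (Sup F)"
  unfolding compact_element_def
proof (intro allI impI)
  fix H assume H: "Sup F \<le> Sup H"
  have "\<forall>x\<in>F. \<exists>E. E \<subseteq> H \<and> finite E \<and> x \<le> Sup E"
    using assms(2) H unfolding compact_element_def by (meson Sup_upper order_trans)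
  then obtain E where E: "\<And>x. x \<in> F \<Longrightarrow> E x \<subseteq> H \<and> finite (E x) \<and> x \<le> Sup (E x)"
    by metis
  have "Sup F \<le> Sup (\<Union>(E ` F))"
    using E by (intro Sup_least) (meson Sup_subset_mono UN_upper order_trans)
  then show "\<exists>E. E \<subseteq> H \<and> finite E \<and> Sup F \<le> Sup E"
    using E assms(1) by (intro exI[of _ "\<Union>(E ` F)"]) auto
qed

lemma compact_power:
  "compact_element (c::'a::compactly_generated_multiplicative_lattice) \<Longrightarrow> compact_element (c ^ n)"
  by (induction n) (simp_all add: compact_one compact_mult)

lemma compact_prod:
  assumes "finite S" "\<And>s. s \<in> S \<Longrightarrow> compact_element (f s)"
  shows "compact_element (prod f S :: 'a::compactly_generated_multiplicative_lattice)"
  using assms by (induction S rule: finite_induct) (simp_all add: compact_one compact_mult)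

lemma Sup_compacts_below:
  "Sup {c. compact_element c \<and> c \<le> x} = (x::'a::compactly_generated_multiplicative_lattice)"
proof (rule order_antisym)
  obtain A where "A \<subseteq> {c. compact_element c}" "x = Sup A"
    using compacts_generate unfolding generating_set_def by metis
  then show "x \<le> Sup {c. compact_element c \<and> c \<le> x}"
    by (auto intro!: Sup_subset_mono simp: Sup_upper)
qed (auto intro: Sup_least)

text \<open>A cover of \<open>1\<close> by the compact elements below \<open>x\<close> and those below \<open>y\<close> has a finite subcover.\<close>

lemma comaximal_compacts_below:
  fixes x y :: "'a::compactly_generated_multiplicative_lattice"
  assumes "comaximal x y"
  obtains c d where "compact_element c" "compact_element d" "c \<le> x" "d \<le> y" "comaximal c d"
proof -
  let ?K = "\<lambda>x::'a. {c. compact_element c \<and> c \<le> x}"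
  have "1 \<le> Sup (?K x \<union> ?K y)"
    using assms by (simp add: Sup_union_distrib Sup_compacts_below comaximal_def)
  then obtain F where F: "F \<subseteq> ?K x \<union> ?K y" "finite F" "1 \<le> Sup F"
    using compact_one[unfolded compact_element_def, rule_format] by metis
  let ?c = "Sup (F \<inter> ?K x)" and ?d = "Sup (F \<inter> ?K y)"
  have "F = (F \<inter> ?K x) \<union> (F \<inter> ?K y)" using F(1) by blast
  then have "Sup F = sup ?c ?d" by (metis Sup_union_distrib)
  then have "comaximal ?c ?d"
    using F(3) le_one unfolding comaximal_def by (metis order_antisym)
  moreover have "compact_element ?c" "compact_element ?d"
    using F(2) by (auto intro: compact_Sup_finite)
  moreover have "?c \<le> x" "?d \<le> y" by (auto intro: Sup_least)
  ultimately show thesis by (rule that[rotated 4])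
qed

text \<open>Finitely many pairwise comaximal elements can be replaced by compact elements below them at
  once: for each member, join up the compact elements found for all pairs that involve it.\<close>

lemma pairwise_comaximal_compacts_below:
  fixes M :: "'a::compactly_generated_multiplicative_lattice set"
  assumes fin: "finite M" and co: "\<And>p q. p \<in> M \<Longrightarrow> q \<in> M \<Longrightarrow> p \<noteq> q \<Longrightarrow> comaximal p q"
  obtains c where "\<And>p. p \<in> M \<Longrightarrow> compact_element (c p)" "\<And>p. p \<in> M \<Longrightarrow> c p \<le> p"
    "\<And>p q. p \<in> M \<Longrightarrow> q \<in> M \<Longrightarrow> p \<noteq> q \<Longrightarrow> comaximal (c p) (c q)"
proof -
  have "\<forall>p q. \<exists>c d. p \<in> M \<and> q \<in> M \<and> p \<noteq> q \<longrightarrow>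
      compact_element c \<and> compact_element d \<and> c \<le> p \<and> d \<le> q \<and> comaximal c d"
    by (metis co comaximal_compacts_below)
  then obtain u v where uv: "\<And>p q. p \<in> M \<Longrightarrow> q \<in> M \<Longrightarrow> p \<noteq> q \<Longrightarrow>
      compact_element (u p q) \<and> compact_element (v p q) \<and> u p q \<le> p \<and> v p q \<le> q \<and>
      comaximal (u p q) (v p q)"
    by metis
  define c where "c p = Sup (u p ` (M - {p}) \<union> (\<lambda>q. v q p) ` (M - {p}))" for p
  show thesis
  proof
    fix p assume p: "p \<in> M"
    show "compact_element (c p)"
      unfolding c_def by (rule compact_Sup_finite) (use fin p uv in auto)
    show "c p \<le> p"
      unfolding c_def by (rule Sup_least) (use p uv in auto)
  next
    fix p q assume pq: "p \<in> M" "q \<in> M" "p \<noteq> q"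
    have "u p q \<le> c p" "v p q \<le> c q"
      unfolding c_def using pq by (auto intro!: Sup_upper)
    then show "comaximal (c p) (c q)"
      using comaximal_mono uv[OF pq] by blast
  qed
qed

section \<open>Existence of primes and maximal elements\<close>

text \<open>The common source of primes and of maximal elements: compactness makes "no member of \<open>K\<close> below
  \<open>x\<close>" pass to joins of chains, so Zorn's lemma applies.\<close>

lemma maximal_avoiding_compacts:
  fixes a :: "'a::complete_lattice"
  assumes K: "\<And>k. k \<in> K \<Longrightarrow> compact_element k" and a: "\<And>k. k \<in> K \<Longrightarrow> \<not> k \<le> a"
  obtains p where "a \<le> p" "\<And>k. k \<in> K \<Longrightarrow> \<not> k \<le> p" "\<And>x. p < x \<Longrightarrow> \<exists>k\<in>K. k \<le> x"
proof -
  let ?A = "{x. a \<le> x \<and> (\<forall>k\<in>K. \<not> k \<le> x)}"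
  have "\<exists>m\<in>?A. \<forall>x\<in>?A. m \<le> x \<longrightarrow> x = m"
  proof (rule predicate_Zorn)
    show "partial_order_on ?A (relation_of (\<le>) ?A)"
      by (rule partial_order_on_relation_ofI) auto
  next
    fix C assume "C \<in> Chains (relation_of (\<le>) ?A)"
    then have sub: "C \<subseteq> ?A" and chain: "\<And>x y. x \<in> C \<Longrightarrow> y \<in> C \<Longrightarrow> x \<le> y \<or> y \<le> x"
      unfolding Chains_def relation_of_def by auto
    show "\<exists>u\<in>?A. \<forall>x\<in>C. x \<le> u"
    proof (cases "C = {}")
      case True
      then show ?thesis using a by auto
    next
      case False
      have "\<not> k \<le> Sup C" if k: "k \<in> K" for k
      proof
        assume "k \<le> Sup C"
        then obtain F where F: "F \<subseteq> C" "finite F" "k \<le> Sup F"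
          using K[OF k] unfolding compact_element_def by blast
        \<comment> \<open>In a chain, the join of a finite subset is bounded by a single member.\<close>
        have "\<exists>x\<in>C. Sup F \<le> x"
          using F(2,1)
        proof (induction F rule: finite_induct)
          case empty
          then show ?case using False by auto
        next
          case (insert y F)
          then obtain x where "x \<in> C" "Sup F \<le> x" by auto
          then show ?case using chain[of x y] insert.prems
            by (auto intro: order_trans)
        qed
        then show False using F(3) sub k by (blast intro: order_trans)
      qed
      moreover have "a \<le> Sup C" using False sub by (blast intro: Sup_upper2)
      ultimately show ?thesis by (auto intro: Sup_upper)
    qed
  qed
  then obtain p where p: "p \<in> ?A" "\<forall>x\<in>?A. p \<le> x \<longrightarrow> x = p" by blast
  show thesis
  proof
    fix x assume "p < x"
    then have "a \<le> x" "p \<le> x" "x \<noteq> p" using p(1) by auto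
    then show "\<exists>k\<in>K. k \<le> x" using p(2) by blast
  qed (use p in auto)
qed

lemma exists_maximal_above:
  fixes a :: "'a::compactly_generated_multiplicative_lattice"
  assumes "a \<noteq> 1"
  obtains m where "maximal_element m" "a \<le> m"
proof -
  have "\<not> k \<le> a" if "k \<in> {1}" for k
    using that assms le_one[of a] by auto
  then obtain m where "a \<le> m" "\<not> 1 \<le> m" "\<And>x. m < x \<Longrightarrow> 1 \<le> x"
    using maximal_avoiding_compacts[of "{1}" a] compact_one by auto
  then show thesis
    using that le_one unfolding maximal_element_def by (metis order_antisym order_le_less)
qed

text \<open>The lattice form of the fact that the intersection of the primes above \<open>a\<close> consists of the
  elements nilpotent modulo \<open>a\<close>: an element that is maximal among those above \<open>a\<close> that lie above no
  power of \<open>c\<close> is prime.\<close>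

lemma power_le_if_below_all_primes:
  fixes a c :: "'a::compactly_generated_multiplicative_lattice"
  assumes c: "compact_element c" and below: "\<And>p. prime_element p \<Longrightarrow> a \<le> p \<Longrightarrow> c \<le> p"
  shows "\<exists>n\<ge>1. c ^ n \<le> a"
proof (rule ccontr)
  assume none: "\<not> ?thesis"
  let ?K = "{c ^ n |n. n \<ge> 1}"
  obtain p where p: "a \<le> p" "\<And>k. k \<in> ?K \<Longrightarrow> \<not> k \<le> p" "\<And>x. p < x \<Longrightarrow> \<exists>k\<in>?K. k \<le> x"
    by (rule maximal_avoiding_compacts[of ?K a]) (use none c compact_power in blast)+
  have c_p: "\<not> c \<le> p"
    using p(2)[of c] by (metis (mono_tags, lifting) mem_Collect_eq order_refl power_one_right)
  have "prime_element p"
    unfolding prime_element_def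
  proof (intro conjI allI impI)
    show "p \<noteq> 1" using c_p le_one by auto
    fix x y assume xy: "x * y \<le> p"
    show "x \<le> p \<or> y \<le> p"
    proof (rule ccontr)
      assume "\<not> ?thesis"
      then have "p < sup p x" "p < sup p y"
        by (metis less_le sup_ge1 sup_ge2)+
      from p(3)[OF this(1)] p(3)[OF this(2)]
      obtain m n where mn: "m \<ge> 1" "c ^ m \<le> sup p x" "c ^ n \<le> sup p y"
        by auto
      have "c ^ (m + n) \<le> sup p x * sup p y"
        using mult_mono_lattice[OF mn(2,3)] by (simp add: power_add)
      also have "\<dots> \<le> sup p (x * y)" by (rule sup_mult_sup_le)
      also have "\<dots> \<le> p" using xy by simp
      finally show False using p(2)[of "c ^ (m + n)"] mn(1)
        by (metis (mono_tags, lifting) mem_Collect_eq trans_le_add1)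
    qed
  qed
  then show False using below p(1) c_p by blast
qed

definition minimal_prime_over ::
    "'a::multiplicative_lattice \<Rightarrow> 'a \<Rightarrow> bool" where
  "minimal_prime_over a p \<longleftrightarrow>
     prime_element p \<and> a \<le> p \<and> (\<forall>q. prime_element q \<longrightarrow> a \<le> q \<longrightarrow> q \<le> p \<longrightarrow> q = p)"

lemma minimal_prime_iff_over_bot: "minimal_prime p \<longleftrightarrow> minimal_prime_over bot p"
  unfolding minimal_prime_def minimal_prime_over_def spectrum_def by auto

text \<open>The meet of a chain of primes is prime, so Zorn's lemma applies downwards.\<close>

lemma exists_minimal_prime_over_below:
  fixes a q :: "'a::multiplicative_lattice"
  assumes q: "prime_element q" "a \<le> q"
  obtains p where "minimal_prime_over a p" "p \<le> q"
proof -
  let ?A = "{p. prime_element p \<and> a \<le> p \<and> p \<le> q}"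
  have "\<exists>m\<in>?A. \<forall>x\<in>?A. m \<ge> x \<longrightarrow> x = m"
  proof (rule predicate_Zorn)
    show "partial_order_on ?A (relation_of (\<ge>) ?A)"
      by (rule partial_order_on_relation_ofI) auto
  next
    fix C assume "C \<in> Chains (relation_of (\<ge>) ?A)"
    then have sub: "C \<subseteq> ?A" and chain: "\<And>x y. x \<in> C \<Longrightarrow> y \<in> C \<Longrightarrow> x \<le> y \<or> y \<le> x"
      unfolding Chains_def relation_of_def by auto
    show "\<exists>u\<in>?A. \<forall>x\<in>C. x \<ge> u"
    proof (cases "C = {}")
      case True
      then show ?thesis using q by auto
    next
      case False
      then obtain r where r: "r \<in> C" by blast
      have "prime_element (Inf C)"
        unfolding prime_element_def
      proof (intro conjI allI impI)
        have "Inf C \<le> r" "r \<noteq> 1"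
          using r sub by (auto intro: Inf_lower simp: prime_element_def)
        then show "Inf C \<noteq> 1" using le_one[of r] by auto
        fix x y assume xy: "x * y \<le> Inf C"
        show "x \<le> Inf C \<or> y \<le> Inf C"
        proof (rule ccontr)
          assume "\<not> ?thesis"
          then obtain s t where st: "s \<in> C" "\<not> x \<le> s" "t \<in> C" "\<not> y \<le> t"
            by (auto simp: le_Inf_iff)
          then obtain w where w: "w \<in> C" "\<not> x \<le> w" "\<not> y \<le> w"
            using chain[of s t] by (meson order_trans)
          moreover have "x * y \<le> w" using xy w(1) by (meson Inf_lower order_trans)
          ultimately show False using sub unfolding prime_element_def by blast
        qed
      qed
      moreover have "a \<le> Inf C" using sub by (auto intro: Inf_greatest)
      moreover have "Inf C \<le> q" using r sub by (auto intro: Inf_lower2)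
      ultimately show ?thesis by (auto intro: Inf_lower)
    qed
  qed
  then obtain p where "p \<in> ?A" "\<forall>x\<in>?A. x \<le> p \<longrightarrow> x = p" by blast
  then show thesis
    by (intro that[of p]) (auto simp: minimal_prime_over_def)
qed

lemma exists_prime_above:
  fixes a :: "'a::compactly_generated_multiplicative_lattice"
  assumes "a \<noteq> 1"
  obtains p where "prime_element p" "a \<le> p"
proof -
  \<comment> \<open>If no prime were above \<open>a\<close>, then \<open>1\<close> would vacuously be below all of them.\<close>
  have "\<not> (\<exists>n\<ge>1. 1 ^ n \<le> a)"
    using assms le_one[of a] by auto
  then show thesis
    using power_le_if_below_all_primes[OF compact_one] that by blast
qed

section \<open>Primes and radicals\<close>

lemma prime_power_le:
  "prime_element p \<Longrightarrow> x ^ n \<le> p \<Longrightarrow> (x::'a::multiplicative_lattice) \<le> p"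
proof (induction n)
  case 0
  then show ?case using le_one by (auto intro: order_trans)
next
  case (Suc n)
  then show ?case by (auto simp: prime_element_def)
qed

lemma prime_prod_le:
  assumes "finite S" "prime_element p" "prod f S \<le> (p::'a::multiplicative_lattice)"
  shows "\<exists>s\<in>S. f s \<le> p"
  using assms
proof (induction S rule: finite_induct)
  case empty
  then show ?case using le_one[of p] by (auto simp: prime_element_def)
next
  case (insert s S)
  then show ?case by (auto simp: prime_element_def)
qed

lemma prime_prod_list_le:
  "prime_element p \<Longrightarrow> prod_list as \<le> (p::'a::multiplicative_lattice) \<Longrightarrow> \<exists>x\<in>set as. x \<le> p"
proof (induction as)
  case Nil
  then show ?case using le_one[of p] by (auto simp: prime_element_def)
next
  case (Cons x as)
  then show ?case by (auto simp: prime_element_def)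
qed

lemma prod_list_le_member: "x \<in> set as \<Longrightarrow> prod_list as \<le> (x::'a::multiplicative_lattice)"
  by (induction as) (auto intro: mult_le_left mult_le_right order_trans)

lemma le_radical: "a \<le> radical (a::'a::multiplicative_lattice)"
  unfolding radical_def by (intro Sup_upper) (auto intro: exI[of _ 1])

lemma radical_le_prime:
  assumes "prime_element p" "a \<le> (p::'a::multiplicative_lattice)"
  shows "radical a \<le> p"
  unfolding radical_def
  by (rule Sup_least) (use assms prime_power_le in \<open>blast intro: order_trans\<close>)

lemma radical_eq_least_prime:
  fixes a p :: "'a::compactly_generated_multiplicative_lattice"
  assumes p: "prime_element p" "a \<le> p" and least: "\<And>q. prime_element q \<Longrightarrow> a \<le> q \<Longrightarrow> p \<le> q"
  shows "radical a = p"
proof (rule order_antisym)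
  have "c \<le> radical a" if "compact_element c" "c \<le> p" for c
    using power_le_if_below_all_primes[OF that(1), of a] least that(2)
    unfolding radical_def by (metis (mono_tags, lifting) Sup_upper mem_Collect_eq order_trans)
  then show "p \<le> radical a"
    by (subst Sup_compacts_below[of p, symmetric]) (auto intro: Sup_least)
qed (rule radical_le_prime[OF p])

section \<open>CPR-factorizations and minimal primes\<close>

lemma CPR_factor_below_prime:
  fixes a p :: "'a::multiplicative_lattice"
  assumes "CPR_factorization a as" "prime_element p" "a \<le> p"
  obtains i where "i < length as" "radical (as ! i) \<le> p"
  using assms prime_prod_list_le radical_le_prime unfolding CPR_factorization_def
  by (metis in_set_conv_nth)

lemma CPR_factorization_le_radical:
  fixes a :: "'a::multiplicative_lattice"
  assumes "CPR_factorization a as" "i < length as"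
  shows "a \<le> radical (as ! i)"
  using assms prod_list_le_member le_radical unfolding CPR_factorization_def
  by (metis nth_mem order_trans)

text \<open>A prime minimal over \<open>a\<close> must be the radical of a factor.\<close>

lemma finite_minimal_primes_over_if_CPR:
  fixes a :: "'a::multiplicative_lattice"
  assumes "has_CPR_factorization a"
  shows "finite {p. minimal_prime_over a p}"
proof -
  obtain as where as: "CPR_factorization a as"
    using assms unfolding has_CPR_factorization_def by blast
  have "p \<in> (\<lambda>i. radical (as ! i)) ` {..<length as}" if p: "minimal_prime_over a p" for p
  proof -
    obtain i where i: "i < length as" "radical (as ! i) \<le> p"
      using CPR_factor_below_prime[OF as] p unfolding minimal_prime_over_def by blast
    moreover have "prime_element (radical (as ! i))"
      using as i unfolding CPR_factorization_def by blast
    ultimately have "radical (as ! i) = p"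
      using p CPR_factorization_le_radical[OF as i(1)] unfolding minimal_prime_over_def by blast
    then show ?thesis using i(1) by blast
  qed
  then show ?thesis by (blast intro: finite_subset[OF _ finite_imageI[OF finite_lessThan]])
qed

text \<open>Choose pairwise comaximal compact elements \<open>c p \<le> p\<close>, for \<open>p\<close> minimal over \<open>a\<close>. Their product lies
  below every prime above \<open>a\<close>, so some \<open>k\<close>-th power of it lies below \<open>a\<close>. The factors are
  \<open>a \<squnion> c p ^ k\<close>: comaximality puts \<open>a\<close> below their product, and the choice of \<open>k\<close> puts the product below
  \<open>a\<close>. No prime minimal over \<open>a\<close> other than \<open>p\<close> is above \<open>c p\<close>, so \<open>p\<close> is the least prime above the
  factor, that is, its radical.\<close>

lemma CPR_factorization_from_minimal_primes:
  fixes a :: "'a::compactly_generated_multiplicative_lattice"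
  assumes a: "a \<noteq> 1" and fin: "finite {p. minimal_prime_over a p}"
    and co: "\<And>p q. minimal_prime_over a p \<Longrightarrow> minimal_prime_over a q \<Longrightarrow> p \<noteq> q \<Longrightarrow> comaximal p q"
  shows "has_CPR_factorization a"
proof -
  define M where "M = {p. minimal_prime_over a p}"
  have finM: "finite M" using fin by (simp add: M_def)
  have prime_M: "prime_element p" "p \<noteq> 1" "a \<le> p" if "p \<in> M" for p
    using that by (auto simp: M_def minimal_prime_over_def prime_element_def)
  obtain c where c: "\<And>p. p \<in> M \<Longrightarrow> compact_element (c p)" "\<And>p. p \<in> M \<Longrightarrow> c p \<le> p"
      "\<And>p q. p \<in> M \<Longrightarrow> q \<in> M \<Longrightarrow> p \<noteq> q \<Longrightarrow> comaximal (c p) (c q)"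
    using pairwise_comaximal_compacts_below[OF finM] co unfolding M_def by blast
  have "prod c M \<le> q" if q: "prime_element q" "a \<le> q" for q
  proof -
    obtain p where p: "p \<in> M" "p \<le> q"
      using exists_minimal_prime_over_below[OF q] unfolding M_def by blast
    then show ?thesis
      using prod_le_factor[OF finM p(1), of c] c(2)[OF p(1)] by (meson order_trans)
  qed
  moreover have "compact_element (prod c M)" by (rule compact_prod[OF finM c(1)])
  ultimately obtain k where k_pos: "k \<ge> 1" and k: "prod c M ^ k \<le> a"
    using power_le_if_below_all_primes[of "prod c M" a] by blast
  define b where "b p = sup a (c p ^ k)" for p
  have b_comax: "comaximal (b p) (b q)" if "p \<in> M" "q \<in> M" "p \<noteq> q" for p q
  proof -
    have "comaximal (c p ^ k) (c q ^ k)"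
      using c(3)[OF that] comaximal_power comaximal_sym by metis
    then show ?thesis unfolding b_def by (rule comaximal_mono) auto
  qed
  have b_le: "b p \<le> p" if "p \<in> M" for p
    using prime_M(3)[OF that] c(2)[OF that] k_pos
    unfolding b_def by (cases k) (auto intro: order_trans[OF mult_le_left])
  have b_radical: "radical (b p) = p" if p: "p \<in> M" for p
  proof (rule radical_eq_least_prime)
    fix q assume q: "prime_element q" "b p \<le> q"
    then obtain r where r: "r \<in> M" "r \<le> q"
      using exists_minimal_prime_over_below[of q a] unfolding M_def b_def by auto
    have "r = p"
    proof (rule ccontr)
      assume "r \<noteq> p"
      then have "sup (b r) (b p) = 1"
        using b_comax r p unfolding comaximal_def by blast
      moreover have "sup (b r) (b p) \<le> q"
        using b_le[OF r(1)] r(2) q(2) by (auto intro: order_trans)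
      ultimately show False using q(1) le_one[of q] by (auto simp: prime_element_def)
    qed
    then show "p \<le> q" using r(2) by simp
  qed (use prime_M b_le p in auto)
  have "prod b M = a"
  proof (rule order_antisym)
    have "prod b M \<le> sup a (\<Prod>p\<in>M. c p ^ k)"
      unfolding b_def by (rule prod_sup_le[OF finM])
    also have "\<dots> \<le> a" using k by (simp add: prod_power)
    finally show "prod b M \<le> a" .
    show "a \<le> prod b M"
      by (rule le_prod_if_pairwise_comaximal[OF finM]) (use b_comax in \<open>auto simp: b_def\<close>)
  qed
  obtain ps where ps: "set ps = M" "distinct ps" using finite_distinct_list[OF finM] by blast
  obtain q where "prime_element q" "a \<le> q" using exists_prime_above[OF a] by blast
  then have "M \<noteq> {}" using exists_minimal_prime_over_below unfolding M_def by blast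
  then have "ps \<noteq> []" using ps by auto
  have "CPR_factorization a (map b ps)"
    unfolding CPR_factorization_def
  proof (intro conjI allI impI)
    show "map b ps \<noteq> []" using \<open>ps \<noteq> []\<close> by simp
    show "a = prod_list (map b ps)"
      using \<open>prod b M = a\<close> ps by (simp flip: prod.distinct_set_conv_list)
  next
    fix i assume "i < length (map b ps)"
    then have i: "i < length ps" "ps ! i \<in> M" using ps by auto
    have "b (ps ! i) \<noteq> 1"
      using b_le[OF i(2)] prime_M(2)[OF i(2)] le_one[of "ps ! i"] by auto
    then show "map b ps ! i \<noteq> 1" using i by simp
    show "prime_element (radical (map b ps ! i))"
      using i b_radical prime_M by simp
  next
    fix i j assume "i < length (map b ps)" "j < length (map b ps)" "i \<noteq> j"
    then show "comaximal (map b ps ! i) (map b ps ! j)"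
      using b_comax ps by (auto simp: nth_eq_iff_index_eq)
  qed
  then show ?thesis unfolding has_CPR_factorization_def by blast
qed

section \<open>Lattices with enough generators\<close>

lemma incomparable_primes_comaximal:
  fixes G :: "'a::multiplicative_lattice set" and p q :: 'a
  assumes avoid: "\<And>a q :: 'a. prime_element q \<Longrightarrow> \<not> a \<le> q \<Longrightarrow> \<exists>g\<in>G. g \<le> a \<and> \<not> g \<le> q"
    and cpr: "\<And>g h. g \<in> G - {1} \<Longrightarrow> h \<in> G - {1} \<Longrightarrow> has_CPR_factorization (g * h)"
    and p: "prime_element p" and q: "prime_element q" and incomp: "\<not> p \<le> q" "\<not> q \<le> p"
  shows "comaximal p q"
proof -
  obtain g where g: "g \<in> G" "g \<le> p" "\<not> g \<le> q" using avoid[OF q incomp(1)] by blast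
  obtain h where h: "h \<in> G" "h \<le> q" "\<not> h \<le> p" using avoid[OF p incomp(2)] by blast
  have "g \<noteq> 1" "h \<noteq> 1"
    using g h le_one[of p] le_one[of q] p q by (auto simp: prime_element_def)
  then obtain as where as: "CPR_factorization (g * h) as"
    using cpr g(1) h(1) unfolding has_CPR_factorization_def by blast
  obtain i where i: "i < length as" "radical (as ! i) \<le> p"
    using CPR_factor_below_prime[OF as p] order_trans[OF mult_le_left g(2)] by blast
  obtain j where j: "j < length as" "radical (as ! j) \<le> q"
    using CPR_factor_below_prime[OF as q] order_trans[OF mult_le_right h(2)] by blast
  have "i \<noteq> j"
  proof
    assume "i = j"
    moreover have "g \<le> radical (as ! i) \<or> h \<le> radical (as ! i)"
      using as i(1) CPR_factorization_le_radical[OF as i(1)]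
      unfolding CPR_factorization_def prime_element_def by blast
    ultimately show False using i(2) j(2) g(3) h(3) by (blast intro: order_trans)
  qed
  then have "comaximal (as ! i) (as ! j)"
    using as i(1) j(1) unfolding CPR_factorization_def by blast
  then show ?thesis
    by (rule comaximal_mono) (use i j le_radical in \<open>blast intro: order_trans\<close>)+
qed

text \<open>If \<open>0\<close> is not prime, then a zero product of nonzero elements gives a zero product of nonzero
  generators below them; these are proper, so by hypothesis \<open>0\<close> has a CPR-factorization.\<close>

lemma finite_minimal_primes:
  fixes G :: "'a::multiplicative_lattice set"
  assumes gen: "generating_set G"
    and cpr: "\<And>g h. g \<in> G - {1} \<Longrightarrow> h \<in> G - {1} \<Longrightarrow> has_CPR_factorization (g * h)"
  shows "finite {p::'a. minimal_prime p}"
proof (cases "prime_element (bot::'a)")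
  case True
  then have "{p::'a. minimal_prime p} \<subseteq> {bot}"
    unfolding minimal_prime_def spectrum_def by fastforce
  then show ?thesis by (rule finite_subset) simp
next
  case False
  then obtain x y :: 'a where xy: "x * y = bot" "x \<noteq> bot" "y \<noteq> bot"
    using bot_neq_one unfolding prime_element_def by (auto simp: bot_unique)
  have nonzero: "\<exists>g\<in>G. g \<le> z \<and> g \<noteq> bot" if z: "z \<noteq> bot" for z
  proof -
    obtain A where A: "A \<subseteq> G" "z = Sup A"
      using gen unfolding generating_set_def by blast
    then have "\<exists>g\<in>A. g \<noteq> bot" using z by auto
    then show ?thesis using A by (auto intro: Sup_upper)
  qed
  obtain g h where gh: "g \<in> G" "g \<le> x" "g \<noteq> bot" "h \<in> G" "h \<le> y" "h \<noteq> bot"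
    using nonzero[OF xy(2)] nonzero[OF xy(3)] by blast
  have prod: "g * h = bot"
    using mult_mono_lattice[OF gh(2,5)] xy(1) by (simp add: bot_unique)
  then have "g \<noteq> 1" "h \<noteq> 1" using gh by auto
  then have "has_CPR_factorization (bot::'a)"
    using cpr[of g h] gh prod by auto
  then show ?thesis
    using finite_minimal_primes_over_if_CPR by (simp add: minimal_prime_iff_over_bot)
qed

text \<open>Each prime minimal over \<open>a\<close> is determined by any maximal element above it.\<close>

lemma finite_minimal_primes_over_above:
  fixes a r :: "'a::compactly_generated_multiplicative_lattice"
  assumes fin: "finite {m. maximal_element m \<and> r \<le> m}"
    and co: "\<And>p q. minimal_prime_over a p \<Longrightarrow> minimal_prime_over a q \<Longrightarrow> p \<noteq> q \<Longrightarrow> comaximal p q"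
  shows "finite {p. minimal_prime_over a p \<and> r \<le> p}"
proof -
  have "\<forall>p. \<exists>m. minimal_prime_over a p \<longrightarrow> maximal_element m \<and> p \<le> m"
    using exists_maximal_above unfolding minimal_prime_over_def prime_element_def by metis
  then obtain m where m: "\<And>p. minimal_prime_over a p \<Longrightarrow> maximal_element (m p) \<and> p \<le> m p"
    by metis
  have "inj_on m {p. minimal_prime_over a p \<and> r \<le> p}"
  proof (rule inj_onI, rule ccontr)
    fix p q assume pq: "p \<in> {p. minimal_prime_over a p \<and> r \<le> p}"
      "q \<in> {p. minimal_prime_over a p \<and> r \<le> p}" "m p = m q" "p \<noteq> q"
    then have "sup p q = 1" "p \<le> m p" "q \<le> m p" "m p \<noteq> 1"
      using co m unfolding comaximal_def maximal_element_def by force+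
    then show False using le_one[of "m p"] by (metis le_supI order_antisym)
  qed
  moreover have "m ` {p. minimal_prime_over a p \<and> r \<le> p} \<subseteq> {m. maximal_element m \<and> r \<le> m}"
    using m by (auto intro: order_trans)
  ultimately show ?thesis using fin by (metis finite_imageD finite_subset)
qed

theorem theorem14:
  fixes G :: "'a::compactly_generated_multiplicative_lattice set"
  assumes "generating_set G"
    and "\<And>p::'a. p \<in> spectrum \<Longrightarrow> \<not> minimal_prime p \<Longrightarrow> finite {m. maximal_element m \<and> p \<le> m}"
    and "\<And>(a::'a) P. finite P \<Longrightarrow> P \<noteq> {} \<Longrightarrow> P \<subseteq> spectrum \<Longrightarrow> (\<And>p. p \<in> P \<Longrightarrow> \<not> a \<le> p) \<Longrightarrow>
           \<exists>g\<in>G. g \<le> a \<and> (\<forall>p\<in>P. \<not> g \<le> p)"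
    and "\<And>g h. g \<in> G - {1} \<Longrightarrow> h \<in> G - {1} \<Longrightarrow> has_CPR_factorization (g * h)"
  shows "CPR_lattice TYPE('a)"
  unfolding CPR_lattice_def
proof (intro allI impI)
  fix a :: 'a assume a: "a \<noteq> 1"
  have avoid: "\<exists>g\<in>G. g \<le> b \<and> \<not> g \<le> q" if "prime_element q" "\<not> b \<le> q" for b q
    using assms(3)[of "{q}" b] that by (auto simp: spectrum_def)
  have co: "comaximal p q" if "minimal_prime_over a p" "minimal_prime_over a q" "p \<noteq> q" for p q
    by (rule incomparable_primes_comaximal[OF avoid assms(4)])
      (use that in \<open>auto simp: minimal_prime_over_def\<close>)
  let ?minimal = "{p::'a. minimal_prime p}"
  have fin_minimal: "finite ?minimal" by (rule finite_minimal_primes[OF assms(1,4)])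
  let ?avoided = "{p \<in> ?minimal. \<not> a \<le> p}"
  have "finite {p. minimal_prime_over a p}"
  proof (cases "?avoided = {}")
    case True
    \<comment> \<open>Here every minimal prime is above \<open>a\<close>, so nothing else is minimal over \<open>a\<close>.\<close>
    have "minimal_prime p" if p: "minimal_prime_over a p" for p
    proof -
      obtain r where r: "minimal_prime_over bot r" "r \<le> p"
        using exists_minimal_prime_over_below[of p bot] p by (auto simp: minimal_prime_over_def)
      then have "a \<le> r" using True by (auto simp: minimal_prime_iff_over_bot)
      then have "r = p" using r p by (auto simp: minimal_prime_over_def)
      then show ?thesis using r by (simp add: minimal_prime_iff_over_bot)
    qed
    then show ?thesis by (auto intro: finite_subset[OF _ fin_minimal])
  next
    case False
    have "finite ?avoided" using fin_minimal by (rule rev_finite_subset) blast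
    moreover have "?avoided \<subseteq> spectrum" by (auto simp: minimal_prime_def)
    ultimately have "\<exists>g\<in>G. g \<le> a \<and> (\<forall>p\<in>?avoided. \<not> g \<le> p)"
      using False by (intro assms(3)) simp_all
    then obtain g where g: "g \<in> G" "g \<le> a" "\<forall>p\<in>?avoided. \<not> g \<le> p" by blast
    have "g \<noteq> 1" using g(2) a le_one[of a] by auto
    then have "finite {r. minimal_prime_over (g * g) r}" (is "finite ?R")
      using assms(4)[of g g] g(1) finite_minimal_primes_over_if_CPR by auto
    moreover have "{p. minimal_prime_over a p} \<subseteq>
        ?minimal \<union> (\<Union>r\<in>{r \<in> ?R. \<not> minimal_prime r}. {p. minimal_prime_over a p \<and> r \<le> p})"
    proof
      fix p assume "p \<in> {p. minimal_prime_over a p}"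
      then have p: "minimal_prime_over a p" by simp
      have "g * g \<le> p"
        using p order_trans[OF mult_le_left g(2)] by (auto simp: minimal_prime_over_def intro: order_trans)
      then obtain r where r: "minimal_prime_over (g * g) r" "r \<le> p"
        using exists_minimal_prime_over_below p unfolding minimal_prime_over_def by blast
      have "p = r" if "minimal_prime r"
      proof -
        have "g \<le> r" using r(1) by (auto simp: minimal_prime_over_def prime_element_def)
        then have "a \<le> r" using g(3) that by auto
        then show ?thesis using p r by (auto simp: minimal_prime_over_def)
      qed
      then show "p \<in> ?minimal \<union>
          (\<Union>r\<in>{r \<in> ?R. \<not> minimal_prime r}. {p. minimal_prime_over a p \<and> r \<le> p})"
        using p r by auto
    qed
    moreover have "finite {p. minimal_prime_over a p \<and> r \<le> p}" if "r \<in> ?R" "\<not> minimal_prime r" for r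
      by (rule finite_minimal_primes_over_above[OF assms(2) co])
        (use that in \<open>auto simp: spectrum_def minimal_prime_over_def\<close>)
    ultimately show ?thesis using fin_minimal by (auto intro: finite_subset)
  qed
  then show "has_CPR_factorization a" using CPR_factorization_from_minimal_primes[OF a] co by blast
qed

end
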